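(* Let $z_1, \dots, z_N \in \mathbb{C}$ be pairwise distinct points, with configuration matrix $A \in \mathbb{C}^{N\times N}$. There exists a nonzero strength vector $\vec{\Gamma} = (\Gamma_1,\dots,\Gamma_N)^T \in \mathbb{C}^N$ for which the configuration $\{z_1,\dots,z_N\}$ is a fixed equilibrium solution of the dynamical system $$\dot{z}_\alpha^{*} = \frac{1}{2\pi i}\sum_{\beta \neq \alpha} \frac{\Gamma_\beta}{z_\alpha - z_\beta}, \qquad \alpha = 1,\dots,N,$$ if and only if $A$ has a (nontrivial) kernel, or equivalently, if there is at least one zero eigenvalue of $A$. If the nullspace dimension of $A$ is one, i.e. there is only one zero eigenvalue of $A$, the choice of $\vec{\Gamma}$ is unique (up to a multiplicative constant). If the nullspace dimension of $A$ is greater than one, the choice of $\vec{\Gamma}$ is not unique and can be any (nonzero) linear combination of the basis elements of the nullspace of $A$.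
   Context: Here $z^*$ denotes the complex conjugate of $z$. A configuration is a collection of pairwise distinct points $z_1,\dots,z_N$ in the complex plane. Its configuration matrix is the skew-symmetric matrix $A = (a_{\alpha\beta}) \in \mathbb{C}^{N\times N}$ with $a_{\alpha\alpha} = 0$ and $a_{\alpha\beta} = \frac{1}{z_\alpha - z_\beta}$ for $\alpha \ne \beta$. Given a strength vector $\vec{\Gamma} \in \mathbb{C}^N$, the configuration is a fixed equilibrium if $\dot z_\alpha^{*} = 0$ for every $\alpha$, i.e. $\sum_{\beta \ne \alpha} \frac{\Gamma_\beta}{z_\alpha - z_\beta} = 0$ for every $\alpha = 1,\dots,N$, which in matrix form is $A\vec{\Gamma} = 0$. *)

theory Defs
  imports
    Complex_Main
    "Jordan_Normal_Form.Matrix_Kernel"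
    "Jordan_Normal_Form.Char_Poly"
    "Jordan_Normal_Form.Jordan_Normal_Form_Uniqueness"
begin

text \<open>Points and strengths are indexed by \<open>0, \<dots>, N - 1\<close>; only the values of \<open>z\<close> on
  \<open>{..<N}\<close> matter.\<close>

definition config_matrix :: "nat \<Rightarrow> (nat \<Rightarrow> complex) \<Rightarrow> complex mat" where
  "config_matrix N z =
     mat N N (\<lambda>(\<alpha>, \<beta>). if \<alpha> = \<beta> then 0 else 1 / (z \<alpha> - z \<beta>))"

text \<open>The dynamical system prescribes the complex conjugate of the velocity of each point, hence
  the outer conjugation.\<close>

definition vortex_velocity :: "nat \<Rightarrow> complex vec \<Rightarrow> (nat \<Rightarrow> complex) \<Rightarrow> nat \<Rightarrow> complex" where
  "vortex_velocity N \<Gamma> z \<alpha> =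
     cnj (1 / (2 * of_real pi * \<i>) * (\<Sum>\<beta> \<in> {..<N} - {\<alpha>}. \<Gamma> $ \<beta> / (z \<alpha> - z \<beta>)))"

definition fixed_equilibrium :: "nat \<Rightarrow> complex vec \<Rightarrow> (nat \<Rightarrow> complex) \<Rightarrow> bool" where
  "fixed_equilibrium N \<Gamma> z \<longleftrightarrow> (\<forall>\<alpha><N. cnj (vortex_velocity N \<Gamma> z \<alpha>) = 0)"

definition equilibrium_strengths :: "nat \<Rightarrow> (nat \<Rightarrow> complex) \<Rightarrow> complex vec set" where
  "equilibrium_strengths N z =
     {\<Gamma> \<in> carrier_vec N. \<Gamma> \<noteq> 0\<^sub>v N \<and> fixed_equilibrium N \<Gamma> z}"

text \<open>The number of eigenvalues of \<open>A\<close> equal to \<open>k\<close>, counted by geometric multiplicity: the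
  dimension of the kernel of \<open>A - k I\<close>. Algebraic multiplicity would be wrong in connection with
  the nullspace dimension: the configuration matrix of the vertices of an equilateral triangle is
  nilpotent with a one-dimensional kernel.\<close>

definition geometric_multiplicity :: "complex mat \<Rightarrow> complex \<Rightarrow> nat" where
  "geometric_multiplicity A k = dim_gen_eigenspace A k 1"

end

theory Submission
  imports Defs
begin

text \<open>Conjugating the conjugated velocity gives back the sum in the dynamical system times
  \<open>1 / (2 * pi * i)\<close>, a nonzero factor. The sum is the \<alpha>-th entry of A times
  \<Gamma>, since the diagonal of A vanishes. The equilibrium strengths are therefore exactly the
  nonzero vectors of the kernel (\<open>fixed_equilibrium_iff_mat_kernel\<close>,
  \<open>equilibrium_strengths_eq\<close>), and everything else is linear algebra of that kernel. An
  eigenvector for 0 is a nonzero kernel vector, and the geometric multiplicity of 0 is the nullity.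
  A kernel of dimension one is a line (\<open>mat_kernel_dim_one\<close>), a larger one is not
  contained in any line (\<open>mat_kernel_dim_gt_one\<close>), and in every case it consists of the
  linear combinations of any basis (\<open>mat_kernel_eq_lincombs\<close>).\<close>

context kernel
begin

text \<open>Some basis is finite, so the kernel is finite-dimensional, and then every linearly
  independent set in it is finite. Hence the final claim can range over all bases, with no
  finiteness assumed.\<close>

lemma finite_basis:
  assumes "basis B"
  shows "finite B"
proof -
  obtain C where "finite C" "basis C"
    using kernel_basis_exists[OF A] by blast
  then have "Ker.fin_dim"
    unfolding Ker.fin_dim_def Ker.basis_def by blast
  then show ?thesis
    using assms Ker.fin_dim_li_fin unfolding Ker.basis_def by blast
qed

lemma span_finite_eq:
  assumes "finite B" "B \<subseteq> mat_kernel A"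
  shows "span B = {lincomb c B | c. True}"
  using Ker.finite_span[OF assms] by auto

lemma mat_kernel_eq_lincombs:
  assumes "basis B"
  shows "mat_kernel A = {lincomb c B | c. True}"
  using span_finite_eq[OF finite_basis[OF assms]] assms unfolding Ker.basis_def by auto

lemma lincomb_singleton:
  assumes "v \<in> mat_kernel A"
  shows "lincomb c {v} = c v \<cdot>\<^sub>v v"
proof -
  have v: "v \<in> carrier_vec nc"
    using assms mat_kernel_carrier[OF A] by auto
  show ?thesis
    using assms v by (simp add: lincomb_same NC.lincomb_def module_vec_simps)
qed

lemma span_singleton:
  assumes "v \<in> mat_kernel A"
  shows "span {v} = {c \<cdot>\<^sub>v v | c. True}"
proof -
  have "span {v} = range (\<lambda>c. lincomb c {v})"
    using span_finite_eq[of "{v}"] assms by (simp add: full_SetCompr_eq)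
  also have "\<dots> = range (\<lambda>c. c v \<cdot>\<^sub>v v)"
    by (simp only: lincomb_singleton[OF assms])
  \<comment> \<open>Coefficients are functions on vectors; a constant function attains any
    prescribed scalar at \<open>v\<close>.\<close>
  also have "\<dots> = range (\<lambda>c. c \<cdot>\<^sub>v v)"
    by (auto intro: range_eqI[where x = "\<lambda>_. _"])
  finally show ?thesis by (simp add: full_SetCompr_eq)
qed

lemma zero_in_mat_kernel: "0\<^sub>v nc \<in> mat_kernel A"
  using A by (intro mat_kernelI) auto

text \<open>A basis of positive cardinality has an element, and a linearly independent set cannot
  contain the zero vector.\<close>

lemma mat_kernel_nontrivial:
  assumes "dim > 0"
  obtains v where "v \<in> mat_kernel A" "v \<noteq> 0\<^sub>v nc"
proof -
  obtain B where B: "finite B" "basis B"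
    using kernel_basis_exists[OF A] by blast
  with assms Ker.dim_basis have "card B > 0" by simp
  then obtain v where "v \<in> B" by fastforce
  moreover have "B \<subseteq> mat_kernel A" "0\<^sub>v nc \<notin> B"
    using B Ker.vs_zero_lin_dep[of B] unfolding Ker.basis_def by auto
  ultimately show thesis using that by blast
qed

lemma mat_kernel_dim_one:
  assumes "dim = 1"
  obtains v where "v \<in> mat_kernel A" "v \<noteq> 0\<^sub>v nc" "mat_kernel A = {c \<cdot>\<^sub>v v | c. True}"
proof -
  obtain B where B: "finite B" "basis B"
    using kernel_basis_exists[OF A] by blast
  with assms Ker.dim_basis have "card B = 1" by simp
  then obtain v where Bv: "B = {v}" by (rule card_1_singletonE)
  with B have v: "v \<in> mat_kernel A" and sp: "span {v} = mat_kernel A"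
    unfolding Ker.basis_def by auto
  have eq: "mat_kernel A = {c \<cdot>\<^sub>v v | c. True}"
    using span_singleton[OF v] sp by simp
  obtain w where w: "w \<in> mat_kernel A" "w \<noteq> 0\<^sub>v nc"
    using assms by (auto intro: mat_kernel_nontrivial)
  \<comment> \<open>All multiples of a zero \<open>v\<close> would vanish, leaving no room for
    \<open>w\<close>.\<close>
  have "v \<noteq> 0\<^sub>v nc"
    using w eq by auto
  with v eq that show thesis by blast
qed

text \<open>A spanning set has at least \<open>dim\<close> elements, so one nonzero vector cannot
  span the kernel; any kernel vector off its line serves as \<open>w\<close>.\<close>

lemma mat_kernel_dim_gt_one:
  assumes "dim > 1"
  obtains v w where "v \<in> mat_kernel A" "v \<noteq> 0\<^sub>v nc" "w \<in> mat_kernel A"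
    "\<not> (\<exists>c. w = c \<cdot>\<^sub>v v)"
proof -
  obtain v where v: "v \<in> mat_kernel A" "v \<noteq> 0\<^sub>v nc"
    using assms by (auto intro: mat_kernel_nontrivial)
  have "\<not> mat_kernel A \<subseteq> span {v}"
  proof
    assume "mat_kernel A \<subseteq> span {v}"
    then have "span {v} = mat_kernel A"
      using Ker.span_is_subset2[of "{v}"] v by auto
    then have "dim \<le> card {v}"
      using v by (intro Ker.gen_ge_dim) auto
    with assms show False by simp
  qed
  with v that span_singleton[OF v(1)] show thesis by blast
qed

end

lemma config_matrix_carrier [simp]: "config_matrix N z \<in> carrier_mat N N"
  unfolding config_matrix_def by simp

lemma fixed_equilibrium_iff_mat_kernel:
  assumes "\<Gamma> \<in> carrier_vec N"
  shows "fixed_equilibrium N \<Gamma> z \<longleftrightarrow> \<Gamma> \<in> mat_kernel (config_matrix N z)"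
proof -
  have entry: "(config_matrix N z *\<^sub>v \<Gamma>) $ \<alpha> = (\<Sum>\<beta> \<in> {..<N} - {\<alpha>}. \<Gamma> $ \<beta> / (z \<alpha> - z \<beta>))"
    if "\<alpha> < N" for \<alpha>
  proof -
    have "(config_matrix N z *\<^sub>v \<Gamma>) $ \<alpha>
        = (\<Sum>\<beta><N. (if \<alpha> = \<beta> then 0 else 1 / (z \<alpha> - z \<beta>)) * \<Gamma> $ \<beta>)"
      using that assms by (simp add: config_matrix_def scalar_prod_def lessThan_atLeast0)
    \<comment> \<open>The zero diagonal entry lets the term with \<beta> = \<alpha> be
      dropped.\<close>
    also have "\<dots> = (\<Sum>\<beta> \<in> {..<N} - {\<alpha>}. \<Gamma> $ \<beta> / (z \<alpha> - z \<beta>))"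
      by (intro sum.mono_neutral_cong_right) auto
    finally show ?thesis .
  qed
  \<comment> \<open>The two conjugations cancel, and the nonzero prefactor does not affect
    vanishing.\<close>
  have "fixed_equilibrium N \<Gamma> z \<longleftrightarrow> (\<forall>\<alpha><N. (config_matrix N z *\<^sub>v \<Gamma>) $ \<alpha> = 0)"
    by (simp add: fixed_equilibrium_def vortex_velocity_def entry)
  also have "\<dots> \<longleftrightarrow> config_matrix N z *\<^sub>v \<Gamma> = 0\<^sub>v N"
    by (auto simp: vec_eq_iff config_matrix_def)
  also have "\<dots> \<longleftrightarrow> \<Gamma> \<in> mat_kernel (config_matrix N z)"
    using assms by (simp add: mat_kernel[OF config_matrix_carrier])
  finally show ?thesis .
qed

lemma equilibrium_strengths_eq:
  "equilibrium_strengths N z = mat_kernel (config_matrix N z) - {0\<^sub>v N}"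
  using fixed_equilibrium_iff_mat_kernel mat_kernel_carrier[OF config_matrix_carrier]
  unfolding equilibrium_strengths_def by blast

lemma char_matrix_zero:
  assumes "A \<in> carrier_mat n n"
  shows "char_matrix A 0 = A"
  using assms unfolding char_matrix_def by auto

text \<open>At 0 the characteristic matrix is \<open>A\<close> itself, so eigenvectors for 0 are the
  nonzero kernel vectors.\<close>

lemma eigenvalue_zero_iff_mat_kernel:
  fixes A :: "'a :: field mat"
  assumes A: "A \<in> carrier_mat n n"
  shows "eigenvalue A 0 \<longleftrightarrow> mat_kernel A \<noteq> {0\<^sub>v n}"
proof -
  interpret kernel n n A by unfold_locales (rule A)
  show ?thesis
    using zero_in_mat_kernel
    unfolding eigenvalue_char_matrix[OF A] char_matrix_zero[OF A] mat_kernel[OF A] by auto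
qed

lemma geometric_multiplicity_zero:
  assumes "A \<in> carrier_mat n n"
  shows "geometric_multiplicity A 0 = kernel_dim A"
  using assms by (simp add: geometric_multiplicity_def dim_gen_eigenspace_def char_matrix_zero)

theorem theorem1:
  fixes N :: nat and z :: "nat \<Rightarrow> complex" and A :: "complex mat"
  assumes "inj_on z {..<N}"
    and "A = config_matrix N z"
  shows "((\<exists>\<Gamma> \<in> carrier_vec N. \<Gamma> \<noteq> 0\<^sub>v N \<and> fixed_equilibrium N \<Gamma> z)
            \<longleftrightarrow> mat_kernel A \<noteq> {0\<^sub>v N})
    \<and> (mat_kernel A \<noteq> {0\<^sub>v N} \<longleftrightarrow> eigenvalue A 0)
    \<and> (kernel_dim A = 1 \<longleftrightarrow> geometric_multiplicity A 0 = 1)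
    \<and> (kernel_dim A = 1 \<longrightarrow>
         (\<exists>\<Gamma>\<^sub>0 \<in> equilibrium_strengths N z.
            equilibrium_strengths N z = {c \<cdot>\<^sub>v \<Gamma>\<^sub>0 | c. c \<noteq> 0}))
    \<and> (kernel_dim A > 1 \<longrightarrow>
         (\<exists>\<Gamma>\<^sub>1 \<in> equilibrium_strengths N z. \<exists>\<Gamma>\<^sub>2 \<in> equilibrium_strengths N z.
            \<not> (\<exists>c. \<Gamma>\<^sub>2 = c \<cdot>\<^sub>v \<Gamma>\<^sub>1))
       \<and> (\<forall>B. kernel.basis N A B \<longrightarrow>
            equilibrium_strengths N z = {kernel.lincomb N A c B | c. True} - {0\<^sub>v N}))"
proof -
  have carrier: "A \<in> carrier_mat N N"
    unfolding assms(2) by simp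
  interpret kernel N N A by unfold_locales (rule carrier)
  have strengths: "equilibrium_strengths N z = mat_kernel A - {0\<^sub>v N}"
    unfolding assms(2) by (rule equilibrium_strengths_eq)
  have "(\<exists>\<Gamma> \<in> carrier_vec N. \<Gamma> \<noteq> 0\<^sub>v N \<and> fixed_equilibrium N \<Gamma> z)
      \<longleftrightarrow> equilibrium_strengths N z \<noteq> {}"
    unfolding equilibrium_strengths_def by blast
  also have "\<dots> \<longleftrightarrow> mat_kernel A \<noteq> {0\<^sub>v N}"
    unfolding strengths using zero_in_mat_kernel by auto
  finally have exist: "(\<exists>\<Gamma> \<in> carrier_vec N. \<Gamma> \<noteq> 0\<^sub>v N \<and> fixed_equilibrium N \<Gamma> z)
      \<longleftrightarrow> mat_kernel A \<noteq> {0\<^sub>v N}" .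
  have unique: "\<exists>\<Gamma>\<^sub>0 \<in> equilibrium_strengths N z.
      equilibrium_strengths N z = {c \<cdot>\<^sub>v \<Gamma>\<^sub>0 | c. c \<noteq> 0}" if dim1: "dim = 1"
  proof -
    from dim1 obtain v where v: "v \<in> mat_kernel A" "v \<noteq> 0\<^sub>v N"
      and ker: "mat_kernel A = {c \<cdot>\<^sub>v v | c. True}"
      by (rule mat_kernel_dim_one)
    have vN: "v \<in> carrier_vec N"
      using v(1) mat_kernel_carrier[OF carrier] by auto
    \<comment> \<open>Removing the zero vector from the line thus amounts to excluding the scalar
      0.\<close>
    have smult_zero: "c \<cdot>\<^sub>v v = 0\<^sub>v N \<longleftrightarrow> c = 0" for c
      using v(2) vN by (auto simp: vec_eq_iff)
    have "mat_kernel A - {0\<^sub>v N} = {c \<cdot>\<^sub>v v | c. c \<noteq> 0}"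
      unfolding ker by (auto simp: smult_zero)
    with v show ?thesis unfolding strengths by blast
  qed
  have indep: "\<exists>\<Gamma>\<^sub>1 \<in> equilibrium_strengths N z. \<exists>\<Gamma>\<^sub>2 \<in> equilibrium_strengths N z.
      \<not> (\<exists>c. \<Gamma>\<^sub>2 = c \<cdot>\<^sub>v \<Gamma>\<^sub>1)" if dim2: "dim > 1"
  proof -
    from dim2 obtain v w where v: "v \<in> mat_kernel A" "v \<noteq> 0\<^sub>v N" and w: "w \<in> mat_kernel A"
      and ind: "\<not> (\<exists>c. w = c \<cdot>\<^sub>v v)"
      by (rule mat_kernel_dim_gt_one)
    \<comment> \<open>The zero vector is a multiple of \<open>v\<close>, so \<open>w\<close>, which
      is not one, is nonzero and an admissible strength vector.\<close>
    have "0 \<cdot>\<^sub>v v = 0\<^sub>v N"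
      using v(1) mat_kernel_carrier[OF carrier] by auto
    with ind have "w \<noteq> 0\<^sub>v N" by metis
    with v w ind show ?thesis unfolding strengths by blast
  qed
  have combs: "equilibrium_strengths N z = {lincomb c B | c. True} - {0\<^sub>v N}" if "basis B" for B
    using strengths arg_cong[OF mat_kernel_eq_lincombs[OF that], of "\<lambda>K. K - {0\<^sub>v N}"]
    by (rule trans)
  show ?thesis
    \<comment> \<open>After this rewriting both eigenvalue equivalences are reflexive, and the
      nullity is the \<open>dim\<close> of the kernel space.\<close>
    unfolding geometric_multiplicity_zero[OF carrier] eigenvalue_zero_iff_mat_kernel[OF carrier]
      kernel_dim
    by (intro conjI impI allI refl exist unique indep combs)
qed

end
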